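(* Let $\mathcal{H}$ be a real separable Hilbert space, $\mathcal{X}\subseteq\mathcal{H}$ a nonempty closed convex set, and $F:\mathcal{H}\to\mathcal{H}$ a map such that: (i) $F$ is Lipschitz continuous with constant $L>0$ and sequentially weak-to-weak continuous on bounded subsets of $\mathcal{H}$; (ii) $F$ is pseudo-monotone on $\mathcal{X}$; (iii) the solution set $\mathcal{X}_{\ast}$ of $\mathrm{VI}(\mathcal{X},F)$ is nonempty, closed and convex. Let $(\alpha_k)_{k\ge 0}$ and $(\beta_k)_{k\ge 0}$ be real sequences in $(0,1)$ such that, for some $\alpha>0$, $\beta_k\in(\alpha,1-\alpha_k)$ for all $k\ge 0$, and $$\lim_{k\to\infty}\alpha_k=0,\qquad \sum_{k=1}^{\infty}\alpha_k=\infty.$$ Let $\gamma_0>0$, $\rho\in(0,1)$, $x^0\in\mathcal{X}$, and define, for $k\ge 0$, $$z^k=P_{\mathcal{X}}[x^k-\gamma_k F(x^k)],\qquad r^k=z^k+\gamma_k\,(F(x^k)-F(z^k)),\qquad x^{k+1}=(1-\alpha_k-\beta_k)x^k+\beta_k r^k,$$ $$\gamma_{k+1}=\begin{cases}\min\left\{\dfrac{\rho\,\|z^k-x^k\|}{\|F(z^k)-F(x^k)\|},\ \gamma_k\right\} & \text{if } F(z^k)-F(x^k)\neq 0,\\[2mm] \gamma_k & \text{otherwise.}\end{cases}$$ Then $(x^k)_{k\ge 0}$ converges strongly (i.e. in norm) to $p=\operatorname{argmin}\{\|z\|: z\in\mathcal{X}_{\ast}\}$.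
   Context: $\langle\cdot,\cdot\rangle$ and $\|\cdot\|$ are the inner product and induced norm of $\mathcal{H}$. $P_{\mathcal{X}}$ is the metric projection onto $\mathcal{X}$: $P_{\mathcal{X}}(x)=\operatorname{argmin}_{y\in\mathcal{X}}\frac12\|y-x\|^2$. $F$ is pseudo-monotone on $\mathcal{X}$ if for all $x,y\in\mathcal{X}$: $\langle F(x),y-x\rangle\ge 0 \Rightarrow \langle F(y),y-x\rangle\ge 0$. $F$ is sequentially weak-to-weak continuous on bounded subsets if for every (bounded) weakly convergent sequence $x_n\rightharpoonup x$ one has $F(x_n)\rightharpoonup F(x)$. $\mathrm{VI}(\mathcal{X},F)$ is the problem of finding $x^{\ast}\in\mathcal{X}$ such that $\langle F(x^{\ast}),x-x^{\ast}\rangle\ge 0$ for all $x\in\mathcal{X}$; $\mathcal{X}_{\ast}\subset\mathcal{X}$ is its set of solutions. *)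

theory Defs
  imports "HOL-Analysis.Analysis"
begin

text \<open>
  A real Hilbert space is a type of sort \<open>{real_inner, complete_space}\<close>.  The library's
  \<open>closest_point\<close> additionally requires \<open>heine_borel\<close>, i.e. local compactness, which would
  force finite dimension; hence the separate definition of the metric projection.
  It is a choice among minimizers and thus meaningful only where a minimizer exists
  (e.g. for a nonempty closed convex set in a Hilbert space, where it is unique).
\<close>

definition metric_proj :: "'h::real_inner set \<Rightarrow> 'h \<Rightarrow> 'h" where
  "metric_proj X x = arg_min_on (\<lambda>y. (1/2) * (norm (y - x))\<^sup>2) X"

definition pseudo_monotone_on :: "'h::real_inner set \<Rightarrow> ('h \<Rightarrow> 'h) \<Rightarrow> bool" where
  "pseudo_monotone_on X F \<longleftrightarrow>
     (\<forall>x\<in>X. \<forall>y\<in>X. inner (F x) (y - x) \<ge> 0 \<longrightarrow> inner (F y) (y - x) \<ge> 0)"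

definition weakly_converges :: "(nat \<Rightarrow> 'h::real_inner) \<Rightarrow> 'h \<Rightarrow> bool" where
  "weakly_converges u l \<longleftrightarrow> (\<forall>y. (\<lambda>n. inner (u n) y) \<longlonglongrightarrow> inner l y)"

definition seq_weak_weak_continuous_on_bounded :: "('h::real_inner \<Rightarrow> 'h) \<Rightarrow> bool" where
  "seq_weak_weak_continuous_on_bounded F \<longleftrightarrow>
     (\<forall>u l. bounded (range u) \<longrightarrow> weakly_converges u l \<longrightarrow>
            weakly_converges (\<lambda>n. F (u n)) (F l))"

definition VI_solutions :: "'h::real_inner set \<Rightarrow> ('h \<Rightarrow> 'h) \<Rightarrow> 'h set" where
  "VI_solutions X F = {s \<in> X. \<forall>x\<in>X. inner (F s) (x - s) \<ge> 0}"

end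

theory Submission
  imports Defs
begin

text \<open>
  Let \<open>p\<close> be the solution of least norm and \<open>G k = \<parallel>x k - p\<parallel>\<^sup>2\<close>.  The step sizes decrease to a positive
  limit, so eventually \<open>\<parallel>r k - p\<parallel>\<^sup>2 \<le> \<parallel>x k - p\<parallel>\<^sup>2 - \<delta> \<parallel>z k - x k\<parallel>\<^sup>2\<close> for some \<open>\<delta> > 0\<close>, which gives
  boundedness, a descent inequality for \<open>G\<close> with error \<open>O(\<alpha> k)\<close>, and
  \<open>G (k+1) \<le> (1 - \<alpha> k) G k - 2 \<alpha> k \<langle>p, x (k+1) - p\<rangle>\<close>.  Given \<open>\<epsilon> > 0\<close>, there is \<open>\<eta> > 0\<close> such that, for
  large \<open>k\<close>, \<open>G (k+1) \<ge> G k - \<eta>\<close> forces \<open>-2 \<langle>p, x (k+1) - p\<rangle> \<le> \<epsilon>\<close>: otherwise \<open>z k - x k\<close> tends to 0 along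
  a subsequence with a weak limit, which solves the variational inequality, against the minimality
  of \<open>p\<close>.  If instead \<open>G\<close> drops by \<open>\<eta>\<close>, this exceeds \<open>\<alpha> k G k\<close> for large \<open>k\<close>.  In both cases
  \<open>G (k+1) \<le> (1 - \<alpha> k) G k + \<alpha> k \<epsilon>\<close>, so \<open>limsup G \<le> \<epsilon>\<close> because the \<open>\<alpha> k\<close> have divergent sum.
\<close>

section \<open>Nearest points in closed convex sets and the metric projection\<close>

lemma arg_min_on_attained:
  fixes f :: "'a \<Rightarrow> 'b::linorder"
  assumes "y \<in> S" "\<And>w. w \<in> S \<Longrightarrow> f y \<le> f w"
  shows "arg_min_on f S \<in> S" "w \<in> S \<Longrightarrow> f (arg_min_on f S) \<le> f w"
proof -
  have "is_arg_min f (\<lambda>w. w \<in> S) (arg_min_on f S)"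
    unfolding arg_min_on_def arg_min_def
    by (rule someI[of _ y]) (use assms in \<open>auto simp: is_arg_min_linorder\<close>)
  then show "arg_min_on f S \<in> S" "w \<in> S \<Longrightarrow> f (arg_min_on f S) \<le> f w"
    by (auto simp: is_arg_min_linorder)
qed

text \<open>The parallelogram law for \<open>u - a\<close> and \<open>v - a\<close>. It forces two
  points that nearly minimize the distance to \<open>a\<close> to be close to each other once their
  midpoint is also a competitor.\<close>

lemma midpoint_parallelogram:
  fixes u v a :: "'h::real_inner"
  shows "(norm (u - v))\<^sup>2 =
    2 * (norm (u - a))\<^sup>2 + 2 * (norm (v - a))\<^sup>2 - 4 * (norm ((1/2) *\<^sub>R u + (1/2) *\<^sub>R v - a))\<^sup>2"
  unfolding power2_norm_eq_inner
  by (simp add: inner_diff_left inner_diff_right inner_add_left inner_add_right inner_commute algebra_simps)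

text \<open>Convexity keeps midpoints in \<open>S\<close>, so by the parallelogram law a minimizing
  sequence is Cauchy; completeness takes the place of compactness.\<close>

lemma nearest_point_exists:
  fixes S :: "'h::{real_inner, complete_space} set"
  assumes "S \<noteq> {}" "closed S" "convex S"
  obtains y where "y \<in> S" "\<And>w. w \<in> S \<Longrightarrow> norm (y - a) \<le> norm (w - a)"
proof -
  define d where "d = (INF w\<in>S. (norm (w - a))\<^sup>2)"
  have bdd: "bdd_below ((\<lambda>w. (norm (w - a))\<^sup>2) ` S)"
    by (rule bdd_belowI2[where m = 0]) simp
  have lower: "d \<le> (norm (w - a))\<^sup>2" if "w \<in> S" for w
    unfolding d_def using bdd that by (rule cINF_lower)
  have "\<exists>w\<in>S. (norm (w - a))\<^sup>2 < d + inverse (real (Suc n))" for n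
    using cINF_less_iff[OF assms(1) bdd, of "d + inverse (real (Suc n))"] by (simp add: d_def)
  then obtain u where uS: "\<And>n. u n \<in> S"
    and u: "\<And>n. (norm (u n - a))\<^sup>2 < d + inverse (real (Suc n))"
    by metis
  have dist_u: "(norm (u m - u n))\<^sup>2 \<le> 2 * inverse (real (Suc m)) + 2 * inverse (real (Suc n))" for m n
  proof -
    have "(1/2) *\<^sub>R u m + (1/2) *\<^sub>R u n \<in> S"
      using convexD[OF assms(3) uS uS, of "1/2" "1/2"] by simp
    then show ?thesis
      using midpoint_parallelogram[of "u m" "u n" a] lower u[of m] u[of n] by fastforce
  qed
  have "Cauchy u"
  proof (rule metric_CauchyI)
    fix e :: real assume "0 < e"
    then obtain N where N: "inverse (real (Suc N)) < e\<^sup>2 / 4"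
      using reals_Archimedean[of "e\<^sup>2 / 4"] by auto
    have "dist (u m) (u n) < e" if "m \<ge> N" "n \<ge> N" for m n
    proof -
      have "inverse (real (Suc m)) \<le> inverse (real (Suc N))" "inverse (real (Suc n)) \<le> inverse (real (Suc N))"
        using that by (auto intro!: le_imp_inverse_le)
      then have "(norm (u m - u n))\<^sup>2 < e\<^sup>2"
        using dist_u[of m n] N by linarith
      then show ?thesis
        using \<open>0 < e\<close> by (simp add: dist_norm power2_less_imp_less)
    qed
    then show "\<exists>M. \<forall>m\<ge>M. \<forall>n\<ge>M. dist (u m) (u n) < e" by blast
  qed
  then obtain l where l: "u \<longlonglongrightarrow> l"
    using Cauchy_convergent_iff convergent_def by blast
  have "l \<in> S"
    using closed_sequentially[OF assms(2) _ l] uS by blast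
  moreover have "norm (l - a) \<le> norm (w - a)" if "w \<in> S" for w
  proof -
    have "(\<lambda>n. (norm (u n - a))\<^sup>2) \<longlonglongrightarrow> (norm (l - a))\<^sup>2"
      by (intro tendsto_intros l)
    moreover have "(\<lambda>n. d + inverse (real (Suc n))) \<longlonglongrightarrow> d + 0"
      by (intro tendsto_intros LIMSEQ_inverse_real_of_nat)
    ultimately have "(norm (l - a))\<^sup>2 \<le> d + 0"
      by (rule LIMSEQ_le) (use u in \<open>auto intro: less_imp_le\<close>)
    then show ?thesis
      using lower[OF that] by (auto intro: order_trans power2_le_imp_le[OF _ norm_ge_zero])
  qed
  ultimately show ?thesis by (rule that)
qed

text \<open>If the angle at \<open>y\<close> were acute, a short move from \<open>y\<close> towards
  \<open>w\<close> would stay in \<open>S\<close> and come closer to \<open>a\<close>.\<close>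

lemma nearest_point_variational:
  fixes S :: "'h::real_inner set"
  assumes "convex S" "y \<in> S" "\<And>w. w \<in> S \<Longrightarrow> norm (y - a) \<le> norm (w - a)" "w \<in> S"
  shows "inner (a - y) (w - y) \<le> 0"
proof (rule ccontr)
  assume "\<not> ?thesis"
  then obtain t where t: "t > 0" "t \<le> 1" "dist (y + t *\<^sub>R (w - y)) a < dist y a"
    using closer_point_lemma[of a y w] by auto
  have "y + t *\<^sub>R (w - y) \<in> S"
    using convexD_alt[OF assms(1,2,4), of t] t by (simp add: algebra_simps)
  with assms(3) t(3) show False
    by (fastforce simp: dist_norm)
qed

text \<open>Half the squared distance and the distance have the same minimizers, so the chosen
  minimizer is a nearest point.\<close>

lemma metric_proj_variational:
  fixes X :: "'h::{real_inner, complete_space} set"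
  assumes "X \<noteq> {}" "closed X" "convex X"
  shows "metric_proj X a \<in> X"
    and "w \<in> X \<Longrightarrow> inner (a - metric_proj X a) (w - metric_proj X a) \<le> 0"
proof -
  obtain y where y: "y \<in> X" "\<And>w. w \<in> X \<Longrightarrow> norm (y - a) \<le> norm (w - a)"
    using nearest_point_exists[OF assms] by blast
  define f where "f w = (1/2) * (norm (w - a))\<^sup>2" for w
  have f: "metric_proj X a = arg_min_on f X"
    by (simp only: metric_proj_def f_def[abs_def])
  have le: "f y \<le> f w" if "w \<in> X" for w
    using y(2)[OF that] by (simp add: f_def power_mono)
  show mem: "metric_proj X a \<in> X"
    unfolding f using y(1) le by (rule arg_min_on_attained)
  have "norm (metric_proj X a - a) \<le> norm (w - a)" if "w \<in> X" for w
    using arg_min_on_attained(2)[of y X f, OF y(1) le that]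
    unfolding f[symmetric] by (auto simp: f_def intro: power2_le_imp_le[OF _ norm_ge_zero])
  then show "w \<in> X \<Longrightarrow> inner (a - metric_proj X a) (w - metric_proj X a) \<le> 0"
    by (rule nearest_point_variational[OF assms(3) mem])
qed

text \<open>The least-norm element is the nearest point to the origin, so the angle condition
  applies with \<open>a = 0\<close>.\<close>

lemma arg_min_norm_variational:
  fixes S :: "'h::{real_inner, complete_space} set"
  assumes "S \<noteq> {}" "closed S" "convex S"
  shows "arg_min_on norm S \<in> S"
    and "s \<in> S \<Longrightarrow> inner (arg_min_on norm S) (s - arg_min_on norm S) \<ge> 0"
proof -
  obtain y where y: "y \<in> S" "\<And>w. w \<in> S \<Longrightarrow> norm y \<le> norm w"
    using nearest_point_exists[OF assms, of 0] by auto
  show mem: "arg_min_on norm S \<in> S"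
    using y by (rule arg_min_on_attained)
  show "inner (arg_min_on norm S) (s - arg_min_on norm S) \<ge> 0" if "s \<in> S"
    using nearest_point_variational[OF assms(3) mem _ that, of 0] arg_min_on_attained(2)[of y S norm, OF y]
    by simp
qed

section \<open>Riesz representation and weak sequential compactness\<close>

text \<open>For \<open>e\<close> outside the kernel, \<open>e\<close> minus its nearest point in the
  kernel is orthogonal to the kernel, and every \<open>y\<close> differs from a multiple of this
  vector by an element of the kernel.\<close>

lemma riesz_representation:
  fixes f :: "'h::{real_inner, complete_space} \<Rightarrow> real"
  assumes "bounded_linear f"
  obtains l where "\<And>y. f y = inner l y"
proof (cases "\<forall>y. f y = 0")
  case True
  then show ?thesis using that[of 0] by simp
next
  case False
  then obtain e where e: "f e \<noteq> 0" by blast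
  interpret bounded_linear f by fact
  let ?K = "{y. f y = 0}"
  have "0 \<in> ?K" using zero by simp
  moreover have "closed ?K"
    by (intro closed_Collect_eq linear_continuous_on assms continuous_on_const)
  moreover have K: "convex ?K"
    by (simp add: convex_def add scaleR)
  ultimately obtain q where q: "q \<in> ?K" "\<And>w. w \<in> ?K \<Longrightarrow> norm (q - e) \<le> norm (w - e)"
    using nearest_point_exists[of ?K e] by (metis empty_iff)
  define h where "h = e - q"
  have fh: "f h = f e" and "h \<noteq> 0"
    using q(1) e zero by (auto simp: h_def diff)
  \<comment> \<open>Both \<open>q + w\<close> and \<open>q - w\<close> lie in the kernel, so the
    one-sided angle condition becomes an equality.\<close>
  have orth: "inner h w = 0" if "f w = 0" for w
    using nearest_point_variational[OF K q, of "q + w"]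
      nearest_point_variational[OF K q, of "q - w"] q(1) that
    by (simp add: h_def add diff)
  have "f y = inner ((f h / inner h h) *\<^sub>R h) y" for y
  proof -
    have "inner h (y - (f y / f h) *\<^sub>R h) = 0"
      by (rule orth) (use e fh in \<open>simp add: diff scaleR\<close>)
    then show ?thesis
      using e fh \<open>h \<noteq> 0\<close> by (simp add: inner_diff_right field_simps)
  qed
  then show ?thesis by (rule that)
qed

text \<open>Inner products with a countable dense set converge along a subsequence by compactness;
  density and boundedness extend this to all vectors, and Riesz turns the limit functional into a
  vector.\<close>

lemma bounded_imp_weakly_convergent_subsequence:
  fixes u :: "nat \<Rightarrow> 'h::{real_inner, complete_space}"
  assumes sep: "separable_space (euclidean :: 'h topology)" and bdd: "bounded (range u)"
  obtains s l where "strict_mono (s :: nat \<Rightarrow> nat)" "weakly_converges (u \<circ> s) l"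
proof -
  obtain C :: "'h set" where C: "countable C" "closure C = UNIV"
    using sep by (auto simp: separable_space_def)
  then have "C \<noteq> {}" by auto
  define d where "d = from_nat_into C"
  have range_d: "range d = C"
    unfolding d_def using \<open>C \<noteq> {}\<close> C(1) by (rule range_from_nat_into)
  obtain B where "B > 0" and B: "\<And>n. norm (u n) \<le> B"
    using bdd unfolding bounded_pos by auto
  have u_le: "\<bar>inner (u n) y\<bar> \<le> B * norm y" for n y
    using Cauchy_Schwarz_ineq2[of "u n" y] B[of n] by (meson mult_right_mono norm_ge_zero order_trans)
  define v where "v n i = inner (u n) (d i)" for n i
  \<comment> \<open>Tychonoff stands in for a diagonal argument: with countably many coordinates,
    the compact product is also sequentially compact.\<close>
  let ?P = "PiE UNIV (\<lambda>i. {- (B * norm (d i))..B * norm (d i)})"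
  have "compactin (product_topology (\<lambda>i::nat. euclideanreal) UNIV) ?P"
    by (subst compactin_PiE) auto
  then have "compact ?P"
    by (simp add: euclidean_product_topology)
  then have "seq_compact ?P"
    by (rule compact_imp_seq_compact)
  moreover have "\<forall>n. v n \<in> ?P"
    using u_le by (auto simp: v_def abs_le_iff minus_le_iff)
  ultimately obtain f s where s: "strict_mono s" and f: "(v \<circ> s) \<longlonglongrightarrow> f"
    by (meson seq_compactE)
  have conv_d: "(\<lambda>n. inner (u (s n)) (d i)) \<longlonglongrightarrow> f i" for i
    using continuous_on_tendsto_compose[OF continuous_on_product_coordinates[where i = i] f]
    by (simp add: v_def)
  have "Cauchy (\<lambda>n. inner (u (s n)) y)" for y
  proof (rule metric_CauchyI)
    fix e :: real assume "0 < e"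
    have "y \<in> closure (range d)" using C range_d by simp
    \<comment> \<open>Each \<open>inner (u n)\<close> is Lipschitz with constant \<open>B\<close>,
      so replacing \<open>y\<close> by \<open>d i\<close> costs less than \<open>e / 4\<close>; two
      such errors leave \<open>e / 2\<close> for the Cauchy estimate at \<open>d i\<close>.\<close>
    then obtain i where i: "norm (y - d i) < e / (4 * B)"
      using \<open>0 < e\<close> \<open>0 < B\<close> unfolding closure_approachable
      by (metis dist_norm dist_commute rangeE divide_pos_pos mult_pos_pos zero_less_numeral)
    have close: "\<bar>inner (u n) y - inner (u n) (d i)\<bar> < e / 4" for n
    proof -
      have "\<bar>inner (u n) y - inner (u n) (d i)\<bar> \<le> B * norm (y - d i)"
        using u_le[of n "y - d i"] by (simp add: inner_diff_right)
      also have "\<dots> < e / 4"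
        using i \<open>0 < B\<close> by (simp add: field_simps)
      finally show ?thesis .
    qed
    obtain M where M: "\<And>m n. m \<ge> M \<Longrightarrow> n \<ge> M \<Longrightarrow>
        \<bar>inner (u (s m)) (d i) - inner (u (s n)) (d i)\<bar> < e / 2"
      using metric_CauchyD[OF LIMSEQ_imp_Cauchy[OF conv_d[of i]], of "e / 2"] \<open>0 < e\<close>
      by (auto simp: dist_real_def)
    have "dist (inner (u (s m)) y) (inner (u (s n)) y) < e" if "m \<ge> M" "n \<ge> M" for m n
      using M[OF that] close[of "s m"] close[of "s n"] unfolding dist_real_def by linarith
    then show "\<exists>M. \<forall>m\<ge>M. \<forall>n\<ge>M. dist (inner (u (s m)) y) (inner (u (s n)) y) < e"
      by blast
  qed
  then have "\<exists>c. (\<lambda>n. inner (u (s n)) y) \<longlonglongrightarrow> c" for y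
    using Cauchy_convergent_iff convergent_def by blast
  then obtain g where g: "\<And>y. (\<lambda>n. inner (u (s n)) y) \<longlonglongrightarrow> g y"
    by metis
  have "bounded_linear g"
  proof (rule bounded_linear_intro)
    show "g (y + w) = g y + g w" for y w
      using LIMSEQ_unique[OF g] tendsto_add[OF g g] by (simp add: inner_add_right)
    show "g (c *\<^sub>R y) = c *\<^sub>R g y" for c y
      using LIMSEQ_unique[OF g] tendsto_mult_left[OF g] by simp
    show "norm (g y) \<le> norm y * B" for y
      using LIMSEQ_le_const2[OF tendsto_rabs[OF g]] u_le by (simp add: mult.commute)
  qed
  then obtain l where "\<And>y. g y = inner l y"
    using riesz_representation by blast
  then have "weakly_converges (u \<circ> s) l"
    using g by (simp add: weakly_converges_def)
  with s show ?thesis by (rule that)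
qed

section \<open>Weak limits and the variational inequality\<close>

lemma weakly_converges_inner_diff:
  assumes "weakly_converges u l"
  shows "(\<lambda>n. inner y (u n - q)) \<longlonglongrightarrow> inner y (l - q)"
proof -
  have "(\<lambda>n. inner (u n) y - inner q y) \<longlonglongrightarrow> inner l y - inner q y"
    using assms unfolding weakly_converges_def by (intro tendsto_diff tendsto_const) blast
  then show ?thesis
    by (simp add: inner_commute[of y] inner_diff_left)
qed

text \<open>The angle condition at the nearest point \<open>q\<close> to \<open>l\<close> is linear
  in \<open>u n\<close>, hence passes to the weak limit and gives
  \<open>inner (l - q) (l - q) \<le> 0\<close>.\<close>

lemma weakly_converges_in_closed_convex:
  fixes X :: "'h::{real_inner, complete_space} set"
  assumes "closed X" "convex X" "\<And>n. u n \<in> X" "weakly_converges u l"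
  shows "l \<in> X"
proof -
  have "X \<noteq> {}" using assms(3) by auto
  then obtain q where q: "q \<in> X" "\<And>w. w \<in> X \<Longrightarrow> norm (q - l) \<le> norm (w - l)"
    using nearest_point_exists assms by metis
  have "(\<lambda>n. inner (l - q) (u n - q)) \<longlonglongrightarrow> inner (l - q) (l - q)"
    using assms(4) by (rule weakly_converges_inner_diff)
  moreover have "inner (l - q) (u n - q) \<le> 0" for n
    by (rule nearest_point_variational[OF assms(2) q assms(3)])
  ultimately have "inner (l - q) (l - q) \<le> 0"
    using LIMSEQ_le_const2 by blast
  then have "l - q = 0"
    by (metis inner_gt_zero_iff not_le)
  then show ?thesis using q(1) by simp
qed

lemma weakly_converges_add_null:
  fixes u v :: "nat \<Rightarrow> 'h::real_inner"
  assumes "weakly_converges u l" "(\<lambda>n. v n - u n) \<longlonglongrightarrow> 0"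
  shows "weakly_converges v l"
  unfolding weakly_converges_def
proof
  fix y
  have "(\<lambda>n. inner (u n) y + inner (v n - u n) y) \<longlonglongrightarrow> inner l y + inner 0 y"
    by (intro tendsto_add tendsto_inner[OF assms(2) tendsto_const])
      (use assms(1) in \<open>auto simp only: weakly_converges_def\<close>)
  then show "(\<lambda>n. inner (v n) y) \<longlonglongrightarrow> inner l y"
    by (simp add: inner_diff_left)
qed

text \<open>
  If \<open>y\<close> violates the inequality at \<open>l\<close>, then \<open>u = l + t (y - l)\<close> with small \<open>t > 0\<close> has
  \<open>\<langle>F u, z n - u\<rangle> > 0\<close> eventually, hence \<open>\<langle>F (z n), z n - u\<rangle> \<ge> 0\<close>; adding the asymptotic inequality
  gives \<open>\<langle>F l, y - u\<rangle> \<ge> 0\<close>, a contradiction.  The usual argument perturbs \<open>y\<close> in the direction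
  \<open>F (z n)\<close>, which may leave \<open>X\<close> and so needs pseudo-monotonicity on the whole space.
\<close>

lemma weak_limit_solves_VI:
  fixes X :: "'h::{real_inner, complete_space} set"
  assumes X: "closed X" "convex X" and F: "continuous_on UNIV F" "pseudo_monotone_on X F"
    and zX: "\<And>n. z n \<in> X" and z: "weakly_converges z l"
    and Fz: "weakly_converges (\<lambda>n. F (z n)) (F l)"
    and asym: "\<And>y e. y \<in> X \<Longrightarrow> e > 0 \<Longrightarrow> \<forall>\<^sub>F n in sequentially. inner (F (z n)) (y - z n) \<ge> - e"
  shows "l \<in> VI_solutions X F"
proof -
  have lX: "l \<in> X" by (rule weakly_converges_in_closed_convex[OF X zX z])
  have "inner (F l) (y - l) \<ge> 0" if yX: "y \<in> X" for y
  proof (rule ccontr)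
    assume "\<not> ?thesis"
    then have neg: "inner (F l) (y - l) < 0" by simp
    define p where "p t = l + t *\<^sub>R (y - l)" for t :: real
    have "continuous_on UNIV (\<lambda>t. inner (F (p t)) (y - l))"
      unfolding p_def
      by (intro continuous_on_inner continuous_on_compose2[OF F(1)] continuous_intros) auto
    then have "((\<lambda>t. inner (F (p t)) (y - l)) \<longlongrightarrow> inner (F (p 0)) (y - l)) (at_right 0)"
      by (auto simp: continuous_on_eq_continuous_at isCont_def filterlim_at_split)
    then have "\<forall>\<^sub>F t in at_right 0. inner (F (p t)) (y - l) < 0"
      by (rule order_tendstoD(2)) (use neg in \<open>simp add: p_def\<close>)
    \<comment> \<open>The bound \<open>t < 1\<close> puts \<open>p t\<close> in \<open>X\<close> and
      keeps the factor in \<open>y - p t = (1 - t) *\<^sub>R (y - l)\<close> positive.\<close>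
    moreover have "\<forall>\<^sub>F t in at_right (0::real). t \<in> {0<..<1}"
      by (rule eventually_at_right_real) simp
    ultimately obtain t where t: "inner (F (p t)) (y - l) < 0" "0 < t" "t < 1"
      using eventually_happens'[OF trivial_limit_at_right_real eventually_conj] by fastforce
    have pX: "p t \<in> X"
      using convexD_alt[OF X(2) lX yX, of t] t by (simp add: p_def algebra_simps)
    have "(\<lambda>n. inner (F (p t)) (z n - p t)) \<longlonglongrightarrow> inner (F (p t)) (l - p t)"
      using z by (rule weakly_converges_inner_diff)
    moreover have "inner (F (p t)) (l - p t) > 0"
      using t by (simp add: p_def mult_pos_neg)
    ultimately have "\<forall>\<^sub>F n in sequentially. inner (F (p t)) (z n - p t) > 0"
      by (rule order_tendstoD(1))
    then have A: "\<forall>\<^sub>F n in sequentially. inner (F (z n)) (z n - p t) \<ge> 0"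
      by eventually_elim (use F(2) pX zX in \<open>auto simp: pseudo_monotone_on_def\<close>)
    have lower: "inner (F l) (y - p t) \<ge> - e" if "e > 0" for e
    proof (rule tendsto_lowerbound)
      show "(\<lambda>n. inner (F (z n)) (y - p t)) \<longlonglongrightarrow> inner (F l) (y - p t)"
        using Fz by (simp add: weakly_converges_def)
      show "\<forall>\<^sub>F n in sequentially. - e \<le> inner (F (z n)) (y - p t)"
        using A asym[OF yX that] by eventually_elim (simp add: inner_diff_right)
    qed simp
    have "inner (F l) (y - p t) \<ge> 0"
      using lower[of "- inner (F l) (y - p t) / 2"] by linarith
    moreover have "y - p t = (1 - t) *\<^sub>R (y - l)"
      by (simp add: p_def algebra_simps)
    ultimately show False
      using neg t by (simp add: zero_le_mult_iff)
  qed
  with lX show ?thesis by (simp add: VI_solutions_def)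
qed

section \<open>A real recursion with divergent step sum\<close>

text \<open>The excess over \<open>c\<close> shrinks by
  \<open>1 - \<alpha> k \<le> exp (- \<alpha> k)\<close> per step, hence is bounded by a constant
  times the exponential of minus a divergent sum.\<close>

lemma contraction_recursion_eventually_le:
  fixes s \<alpha> :: "nat \<Rightarrow> real"
  assumes \<alpha>: "\<And>k. 0 \<le> \<alpha> k" "\<And>k. \<alpha> k \<le> 1"
    and \<alpha>_sum: "filterlim (\<lambda>n. \<Sum>k=1..n. \<alpha> k) at_top sequentially"
    and s: "\<forall>\<^sub>F k in sequentially. s (Suc k) \<le> (1 - \<alpha> k) * s k + \<alpha> k * c" and "\<delta> > 0"
  shows "\<forall>\<^sub>F k in sequentially. s k \<le> c + \<delta>"
proof -
  obtain N where N: "\<And>k. k \<ge> N \<Longrightarrow> s (Suc k) \<le> (1 - \<alpha> k) * s k + \<alpha> k * c"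
    using s by (auto simp: eventually_sequentially)
  define A where "A n = (\<Sum>k=1..n. \<alpha> k)" for n
  \<comment> \<open>Truncation at 0 keeps the bound nonnegative, as replacing
    \<open>1 - \<alpha>\<close> by the exponential requires. Starting at \<open>Suc N\<close> makes
    each contraction factor match the summand that \<open>A\<close> gains.\<close>
  define D where "D = max 0 (s (Suc N) - c)"
  have bound: "s (Suc (N + n)) - c \<le> D * exp (A N - A (N + n))" for n
  proof (induction n)
    case (Suc n)
    let ?k = "Suc (N + n)"
    have "s (Suc ?k) - c \<le> (1 - \<alpha> ?k) * (s ?k - c)"
      using N[of ?k] by (simp add: algebra_simps)
    also have "\<dots> \<le> (1 - \<alpha> ?k) * (D * exp (A N - A (N + n)))"
      using Suc \<alpha>(2) by (intro mult_left_mono) auto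
    also have "\<dots> \<le> exp (- \<alpha> ?k) * (D * exp (A N - A (N + n)))"
      using exp_ge_add_one_self[of "- \<alpha> ?k"] by (intro mult_right_mono) (auto simp: D_def)
    also have "\<dots> = D * exp (A N - A (N + Suc n))"
      by (simp add: A_def flip: exp_add)
    finally show ?case by simp
  qed (simp add: D_def)
  have "filterlim (\<lambda>n. A (n + N)) at_top sequentially"
    unfolding A_def by (rule filterlim_compose[OF \<alpha>_sum filterlim_add_const_nat_at_top])
  then have "filterlim (\<lambda>n. - A N + A (N + n)) at_top sequentially"
    using filterlim_tendsto_add_at_top[OF tendsto_const, of _ _ "- A N"] by (simp add: add.commute)
  then have "filterlim (\<lambda>n. A N - A (N + n)) at_bot sequentially"
    by (simp add: filterlim_uminus_at_bot)
  then have "(\<lambda>n. D * exp (A N - A (N + n))) \<longlonglongrightarrow> D * 0"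
    by (intro tendsto_mult_left filterlim_compose[OF exp_at_bot])
  then have "\<forall>\<^sub>F n in sequentially. D * exp (A N - A (N + n)) < \<delta>"
    using \<open>\<delta> > 0\<close> by (intro order_tendstoD) auto
  then have "\<forall>\<^sub>F n in sequentially. s (n + Suc N) \<le> c + \<delta>"
    by eventually_elim (use bound in \<open>smt (verit) add.commute add_Suc_right\<close>)
  then show ?thesis
    by (rule eventually_sequentially_seg[THEN iffD1])
qed

section \<open>Estimates for a single step of the method\<close>

text \<open>Expanding the square leaves two inner products of favourable sign, one from the
  projection and one from \<open>p\<close>; the only harmful term is the squared norm of
  \<open>g *\<^sub>R (F z - F x)\<close>, controlled by \<open>c\<close>.\<close>

lemma tseng_step:
  fixes x z p :: "'h::real_inner" and F :: "'h \<Rightarrow> 'h"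
  assumes proj: "inner (x - g *\<^sub>R F x - z) (p - z) \<le> 0"
    and p: "inner (F z) (z - p) \<ge> 0" and g: "g \<ge> 0"
    and c: "g * norm (F z - F x) \<le> c * norm (z - x)"
  shows "(norm (z + g *\<^sub>R (F x - F z) - p))\<^sup>2 \<le> (norm (x - p))\<^sup>2 - (1 - c\<^sup>2) * (norm (z - x))\<^sup>2"
proof -
  have "(norm (g *\<^sub>R (F z - F x)))\<^sup>2 \<le> (c * norm (z - x))\<^sup>2"
    using c g by (intro power_mono) auto
  moreover have "(norm (z + g *\<^sub>R (F x - F z) - p))\<^sup>2 =
      (norm (x - p))\<^sup>2 - (norm (z - x))\<^sup>2 + 2 * inner (x - g *\<^sub>R F x - z) (p - z)
      - 2 * (g * inner (F z) (z - p)) + (norm (g *\<^sub>R (F z - F x)))\<^sup>2"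
    unfolding power2_norm_eq_inner
    by (simp add: inner_diff_left inner_diff_right inner_add_left inner_add_right inner_commute algebra_simps)
  moreover have "g * inner (F z) (z - p) \<ge> 0"
    using g p by simp
  ultimately show ?thesis
    using proj by (simp add: power_mult_distrib algebra_simps)
qed

text \<open>Dividing the projection inequality by \<open>g\<close> bounds the term with
  \<open>F x\<close>, and the Lipschitz estimate exchanges \<open>F x\<close> for
  \<open>F z\<close>. This supplies the asymptotic inequality of \<open>weak_limit_solves_VI\<close>
  when \<open>z - x\<close> tends to 0.\<close>

lemma tseng_step_residual:
  fixes x y z :: "'h::real_inner" and F :: "'h \<Rightarrow> 'h"
  assumes proj: "inner (x - g *\<^sub>R F x - z) (y - z) \<le> 0"
    and g: "0 < m" "m \<le> g" and Lip: "norm (F z - F x) \<le> L * norm (z - x)"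
  shows "inner (F z) (y - z) \<ge> - ((L + 1 / m) * norm (z - x) * norm (y - z))"
proof -
  have "- (norm (z - x) * norm (y - z)) \<le> g * inner (F x) (y - z)"
    using proj Cauchy_Schwarz_ineq2[of "z - x" "y - z"] by (simp add: inner_diff_left abs_le_iff)
  then have "- (norm (z - x) * norm (y - z) / g) \<le> inner (F x) (y - z)"
    using g by (simp add: field_simps)
  moreover have "norm (z - x) * norm (y - z) / g \<le> norm (z - x) * norm (y - z) / m"
    using g by (intro divide_left_mono) auto
  moreover have "\<bar>inner (F z - F x) (y - z)\<bar> \<le> L * norm (z - x) * norm (y - z)"
    using Cauchy_Schwarz_ineq2[of "F z - F x" "y - z"] Lip
    by (meson mult_right_mono norm_ge_zero order_trans)
  ultimately show ?thesis
    by (simp add: inner_diff_left algebra_simps abs_le_iff)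
qed

text \<open>After the triangle inequality, the gap is the weighted sum of the squared pairwise
  differences of the norms.\<close>

lemma norm_convex_combination3_power2_le:
  fixes a b c :: "'h::real_normed_vector"
  assumes "0 \<le> u" "0 \<le> v" "0 \<le> w" "u + v + w = 1"
  shows "(norm (u *\<^sub>R a + v *\<^sub>R b + w *\<^sub>R c))\<^sup>2
    \<le> u * (norm a)\<^sup>2 + v * (norm b)\<^sup>2 + w * (norm c)\<^sup>2"
proof -
  have "norm (u *\<^sub>R a + v *\<^sub>R b + w *\<^sub>R c) \<le> u * norm a + v * norm b + w * norm c"
    using norm_triangle_ineq[of "u *\<^sub>R a + v *\<^sub>R b" "w *\<^sub>R c"]
      norm_triangle_ineq[of "u *\<^sub>R a" "v *\<^sub>R b"] assms by simp
  then have "(norm (u *\<^sub>R a + v *\<^sub>R b + w *\<^sub>R c))\<^sup>2 \<le> (u * norm a + v * norm b + w * norm c)\<^sup>2"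
    by (rule power_mono) simp
  also have "\<dots> = u * (norm a)\<^sup>2 + v * (norm b)\<^sup>2 + w * (norm c)\<^sup>2
    - (u * v * (norm a - norm b)\<^sup>2 + u * w * (norm a - norm c)\<^sup>2 + v * w * (norm b - norm c)\<^sup>2)"
    using assms(4) by algebra
  also have "\<dots> \<le> u * (norm a)\<^sup>2 + v * (norm b)\<^sup>2 + w * (norm c)\<^sup>2"
    using assms by (simp only: diff_le_eq le_add_same_cancel1) (intro add_nonneg_nonneg mult_nonneg_nonneg zero_le_power2)
  finally show ?thesis .
qed

section \<open>Strong convergence to the least-norm solution\<close>

theorem theorem3p2:
  fixes X :: "'h::{real_inner, complete_space} set"
    and F :: "'h \<Rightarrow> 'h"
    and L a \<rho> :: real
    and \<alpha> \<beta> \<gamma> :: "nat \<Rightarrow> real"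
    and x z r :: "nat \<Rightarrow> 'h"
  assumes separable: "separable_space (euclidean :: 'h topology)"
    and X: "X \<noteq> {}" "closed X" "convex X"
    and Lipschitz: "L > 0" "L-lipschitz_on UNIV F"
    and weak_cont: "seq_weak_weak_continuous_on_bounded F"
    and pseudo_mono: "pseudo_monotone_on X F"
    and solutions: "VI_solutions X F \<noteq> {}" "closed (VI_solutions X F)" "convex (VI_solutions X F)"
    and \<alpha>_range: "\<And>k. \<alpha> k \<in> {0<..<1}"
    and \<beta>_range: "\<And>k. \<beta> k \<in> {0<..<1}"
    and a_pos: "a > 0"
    and \<beta>_bounds: "\<And>k. \<beta> k \<in> {a<..<1 - \<alpha> k}"
    and \<alpha>_lim: "\<alpha> \<longlonglongrightarrow> 0"
    and \<alpha>_sum: "filterlim (\<lambda>n. \<Sum>k=1..n. \<alpha> k) at_top sequentially"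
    and \<gamma>_init: "\<gamma> 0 > 0"
    and \<rho>_range: "\<rho> \<in> {0<..<1}"
    and x_init: "x 0 \<in> X"
    and z_def: "\<And>k. z k = metric_proj X (x k - \<gamma> k *\<^sub>R F (x k))"
    and r_def: "\<And>k. r k = z k + \<gamma> k *\<^sub>R (F (x k) - F (z k))"
    and x_step: "\<And>k. x (Suc k) = (1 - \<alpha> k - \<beta> k) *\<^sub>R x k + \<beta> k *\<^sub>R r k"
    and \<gamma>_step: "\<And>k. \<gamma> (Suc k) =
          (if F (z k) - F (x k) \<noteq> 0
           then min (\<rho> * norm (z k - x k) / norm (F (z k) - F (x k))) (\<gamma> k)
           else \<gamma> k)"
  shows "x \<longlonglongrightarrow> arg_min_on norm (VI_solutions X F)"
proof -
  define p where "p = arg_min_on norm (VI_solutions X F)"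
  have pS: "p \<in> VI_solutions X F"
    and p_min: "\<And>s. s \<in> VI_solutions X F \<Longrightarrow> inner p (s - p) \<ge> 0"
    unfolding p_def using arg_min_norm_variational[OF solutions] by auto
  then have pX: "p \<in> X"
    by (simp add: VI_solutions_def)
  \<comment> \<open>The Minty form of the inequality: pseudo-monotonicity moves the evaluation of
    \<open>F\<close> from \<open>p\<close> to \<open>w\<close>.\<close>
  have Fp: "inner (F w) (w - p) \<ge> 0" if "w \<in> X" for w
    using pS that pseudo_mono by (auto simp: VI_solutions_def pseudo_monotone_on_def)
  have zX: "z k \<in> X"
    and proj: "w \<in> X \<Longrightarrow> inner (x k - \<gamma> k *\<^sub>R F (x k) - z k) (w - z k) \<le> 0" for k w
    unfolding z_def using metric_proj_variational[OF X] by auto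
  have Lip: "norm (F u - F v) \<le> L * norm (u - v)" for u v
    using lipschitz_onD[OF Lipschitz(2), of u v] by (simp add: dist_norm)
  have \<alpha>: "0 < \<alpha> k" "\<alpha> k < 1" and \<beta>: "a < \<beta> k" "\<beta> k < 1 - \<alpha> k" "0 < \<beta> k" "\<beta> k < 1" for k
    using \<alpha>_range[of k] \<beta>_range[of k] \<beta>_bounds[of k] by auto
  have \<rho>: "0 < \<rho>" "\<rho> < 1"
    using \<rho>_range by auto

  \<comment> \<open>Step sizes: monotone, bounded away from zero, convergent\<close>
  define m where "m = min (\<gamma> 0) (\<rho> / L)"
  have "m > 0"
    using \<gamma>_init \<rho> Lipschitz(1) by (simp add: m_def)
  have \<gamma>_ge: "m \<le> \<gamma> k" for k
  proof (induction k)
    case (Suc k)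
    \<comment> \<open>By the Lipschitz bound the denominator is at most
      \<open>L * norm (z k - x k)\<close>.\<close>
    have "\<rho> / L \<le> \<rho> * norm (z k - x k) / norm (F (z k) - F (x k))" if "F (z k) - F (x k) \<noteq> 0"
      using Lip[of "z k" "x k"] that \<rho>(1) Lipschitz(1) by (simp add: field_simps)
    then show ?case
      using Suc unfolding \<gamma>_step[of k] by (auto simp: m_def)
  qed (simp add: m_def)
  have \<gamma>_pos: "\<gamma> k > 0" for k
    using \<gamma>_ge[of k] \<open>m > 0\<close> by simp
  have "decseq \<gamma>"
    unfolding decseq_Suc_iff by (simp add: \<gamma>_step)
  then have \<gamma>_le: "\<gamma> k \<le> \<gamma> 0" for k
    by (simp add: decseqD)
  obtain g where g: "\<gamma> \<longlonglongrightarrow> g" "m \<le> g"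
    using decseq_convergent[OF \<open>decseq \<gamma>\<close>, of m] \<gamma>_ge LIMSEQ_le_const by metis
  have \<gamma>_F: "\<gamma> (Suc k) * norm (F (z k) - F (x k)) \<le> \<rho> * norm (z k - x k)" for k
  proof (cases "F (z k) - F (x k) = 0")
    case False
    then have "\<gamma> (Suc k) \<le> \<rho> * norm (z k - x k) / norm (F (z k) - F (x k))"
      by (simp add: \<gamma>_step)
    with False show ?thesis by (simp add: field_simps)
  qed (use \<rho> in simp)

  \<comment> \<open>Distance estimates relative to \<open>p\<close>\<close>
  define c where "c = (1 + \<rho>) / 2"
  have c: "\<rho> < c" "0 < c" "c < 1"
    using \<rho> by (auto simp: c_def)
  define \<delta> where "\<delta> = 1 - c\<^sup>2"
  have "\<delta> > 0"
    using c by (simp add: \<delta>_def abs_square_less_1)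
  \<comment> \<open>The rule controls \<open>F (z k) - F (x k)\<close> through
    \<open>\<gamma> (Suc k)\<close>, while the step uses \<open>\<gamma> k\<close>. Their ratio
    tends to 1 because the limit \<open>g\<close> is positive, so any \<open>c\<close> strictly
    between \<open>\<rho>\<close> and 1 eventually works.\<close>
  have "(\<lambda>k. \<rho> * \<gamma> k / \<gamma> (Suc k)) \<longlonglongrightarrow> \<rho> * g / g"
    using g \<open>m > 0\<close> by (intro tendsto_intros LIMSEQ_Suc) auto
  then have "\<forall>\<^sub>F k in sequentially. \<rho> * \<gamma> k / \<gamma> (Suc k) < c"
    by (rule order_tendstoD(2)) (use c g \<open>m > 0\<close> in auto)
  then obtain K where K: "\<And>k. k \<ge> K \<Longrightarrow> \<rho> * \<gamma> k / \<gamma> (Suc k) < c"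
    by (auto simp: eventually_sequentially)
  have r_sq: "(norm (r k - p))\<^sup>2 \<le> (norm (x k - p))\<^sup>2 - \<delta> * (norm (z k - x k))\<^sup>2" if "k \<ge> K" for k
    unfolding r_def \<delta>_def
  proof (rule tseng_step)
    have "\<gamma> k * norm (F (z k) - F (x k))
        = \<gamma> k / \<gamma> (Suc k) * (\<gamma> (Suc k) * norm (F (z k) - F (x k)))"
      using \<gamma>_pos[of "Suc k"] by simp
    also have "\<dots> \<le> \<gamma> k / \<gamma> (Suc k) * (\<rho> * norm (z k - x k))"
      using \<gamma>_F \<gamma>_pos[of k] \<gamma>_pos[of "Suc k"] by (intro mult_left_mono) auto
    also have "\<dots> = (\<rho> * \<gamma> k / \<gamma> (Suc k)) * norm (z k - x k)"
      by simp
    also have "\<dots> \<le> c * norm (z k - x k)"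
      using K[OF that] by (intro mult_right_mono) auto
    finally show "\<gamma> k * norm (F (z k) - F (x k)) \<le> c * norm (z k - x k)" .
  qed (use proj[OF pX] Fp[OF zX] \<gamma>_pos[of k] in auto)
  have r_le: "norm (r k - p) \<le> norm (x k - p)" if "k \<ge> K" for k
    using r_sq[OF that] \<open>\<delta> > 0\<close>
    by (intro power2_le_imp_le[OF _ norm_ge_zero]) (smt (verit) mult_nonneg_nonneg zero_le_power2)
  \<comment> \<open>The new iterate is a convex combination of \<open>x k\<close>,
    \<open>r k\<close> and the origin; seen from \<open>p\<close>, the origin is
    \<open>- p\<close>.\<close>
  have x_Suc: "x (Suc k) - p = (1 - \<alpha> k - \<beta> k) *\<^sub>R (x k - p) + \<beta> k *\<^sub>R (r k - p) + \<alpha> k *\<^sub>R (- p)" for k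
    by (simp add: x_step algebra_simps)
  have q_le: "norm ((1 - \<alpha> k - \<beta> k) *\<^sub>R (x k - p) + \<beta> k *\<^sub>R (r k - p)) \<le> (1 - \<alpha> k) * norm (x k - p)"
    if "k \<ge> K" for k
  proof -
    have "norm ((1 - \<alpha> k - \<beta> k) *\<^sub>R (x k - p) + \<beta> k *\<^sub>R (r k - p))
        \<le> (1 - \<alpha> k - \<beta> k) * norm (x k - p) + \<beta> k * norm (r k - p)"
      using norm_triangle_ineq[of "(1 - \<alpha> k - \<beta> k) *\<^sub>R (x k - p)" "\<beta> k *\<^sub>R (r k - p)"] \<beta>[of k]
      by simp
    also have "\<dots> \<le> (1 - \<alpha> k - \<beta> k) * norm (x k - p) + \<beta> k * norm (x k - p)"
      using r_le[OF that] \<beta>[of k] by simp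
    finally show ?thesis by (simp add: algebra_simps)
  qed

  \<comment> \<open>The ball of radius \<open>B\<close> about \<open>p\<close> must also contain the
    origin, which enters with weight \<open>\<alpha> k\<close>.\<close>
  define B where "B = max (norm (x K - p)) (norm p)"
  have "norm (x (K + n) - p) \<le> B" for n
  proof (induction n)
    case (Suc n)
    let ?k = "K + n"
    have "norm (x (Suc ?k) - p) \<le> (1 - \<alpha> ?k) * norm (x ?k - p) + \<alpha> ?k * norm p"
      unfolding x_Suc
      using norm_triangle_ineq[of "(1 - \<alpha> ?k - \<beta> ?k) *\<^sub>R (x ?k - p) + \<beta> ?k *\<^sub>R (r ?k - p)"
          "\<alpha> ?k *\<^sub>R (- p)"] q_le[of ?k] \<alpha>[of ?k]
      by simp
    also have "\<dots> \<le> (1 - \<alpha> ?k) * B + \<alpha> ?k * B"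
      using Suc \<alpha>[of ?k] by (intro add_mono mult_left_mono) (auto simp: B_def)
    finally show ?case by (simp add: algebra_simps)
  qed (simp add: B_def)
  then have B: "norm (x k - p) \<le> B" if "k \<ge> K" for k
    using that by (metis le_add_diff_inverse)

  define G where "G k = (norm (x k - p))\<^sup>2" for k
  \<comment> \<open>The residual term is kept, with \<open>\<beta> k\<close> replaced by its lower
    bound \<open>a\<close>, so that a small drop of \<open>G\<close> forces a small
    residual.\<close>
  have descent: "G (Suc k) \<le> G k - a * \<delta> * (norm (z k - x k))\<^sup>2 + \<alpha> k * (norm p)\<^sup>2" if "k \<ge> K" for k
  proof -
    have "G (Suc k) \<le> (1 - \<alpha> k - \<beta> k) * G k + \<beta> k * (norm (r k - p))\<^sup>2 + \<alpha> k * (norm (- p))\<^sup>2"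
      unfolding G_def x_Suc
      by (rule norm_convex_combination3_power2_le) (use \<alpha>[of k] \<beta>[of k] in auto)
    also have "\<beta> k * (norm (r k - p))\<^sup>2 \<le> \<beta> k * (G k - \<delta> * (norm (z k - x k))\<^sup>2)"
      using r_sq[OF that] \<beta>[of k] by (simp add: G_def)
    finally have "G (Suc k) \<le> (1 - \<alpha> k) * G k - \<beta> k * (\<delta> * (norm (z k - x k))\<^sup>2) + \<alpha> k * (norm p)\<^sup>2"
      by (simp add: algebra_simps)
    moreover have "a * (\<delta> * (norm (z k - x k))\<^sup>2) \<le> \<beta> k * (\<delta> * (norm (z k - x k))\<^sup>2)"
      using \<beta>[of k] \<open>\<delta> > 0\<close> by (intro mult_right_mono) auto
    moreover have "(1 - \<alpha> k) * G k \<le> G k"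
      using \<alpha>[of k] by (simp add: G_def mult_left_le_one_le)
    ultimately show ?thesis by (simp add: mult.assoc)
  qed
  \<comment> \<open>Here \<open>- \<alpha> k *\<^sub>R p\<close> is split off before squaring, so
    that it contributes a cross term with \<open>x (Suc k) - p\<close> and a square of favourable
    sign.\<close>
  have contraction: "G (Suc k) \<le> (1 - \<alpha> k) * G k + \<alpha> k * (- 2 * inner p (x (Suc k) - p))"
    if "k \<ge> K" for k
  proof -
    define q where "q = (1 - \<alpha> k - \<beta> k) *\<^sub>R (x k - p) + \<beta> k *\<^sub>R (r k - p)"
    have q: "q = (x (Suc k) - p) + \<alpha> k *\<^sub>R p"
      by (simp add: q_def x_Suc)
    have "(norm q)\<^sup>2 = G (Suc k) + 2 * \<alpha> k * inner p (x (Suc k) - p) + (\<alpha> k)\<^sup>2 * (norm p)\<^sup>2"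
      unfolding q G_def power2_norm_eq_inner
      by (simp add: inner_add_left inner_add_right inner_commute power2_eq_square algebra_simps)
    moreover have "(norm q)\<^sup>2 \<le> (1 - \<alpha> k) * G k"
    proof -
      have "(norm q)\<^sup>2 \<le> ((1 - \<alpha> k) * norm (x k - p))\<^sup>2"
        using q_le[OF that] by (auto simp: q_def intro: power_mono)
      also have "\<dots> = (1 - \<alpha> k) * ((1 - \<alpha> k) * G k)"
        by (simp add: G_def power2_eq_square)
      also have "\<dots> \<le> (1 - \<alpha> k) * G k"
        using \<alpha>[of k] by (intro mult_left_mono mult_left_le_one_le) (auto simp: G_def)
      finally show ?thesis .
    qed
    moreover have "0 \<le> (\<alpha> k)\<^sup>2 * (norm p)\<^sup>2"
      by simp
    moreover have "\<alpha> k * (- 2 * inner p (x (Suc k) - p)) = - (2 * \<alpha> k * inner p (x (Suc k) - p))"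
      by simp
    ultimately show ?thesis by linarith
  qed

  \<comment> \<open>Weak cluster points along steps with little descent\<close>
  have key: "\<exists>\<eta>>0. \<exists>N. \<forall>k\<ge>N. G (Suc k) \<ge> G k - \<eta> \<longrightarrow> - 2 * inner p (x (Suc k) - p) \<le> \<epsilon>"
    if "\<epsilon> > 0" for \<epsilon>
  proof (rule ccontr)
    assume "\<not> ?thesis"
    \<comment> \<open>The negation is used with \<open>\<eta> = 1 / (n + 1)\<close> and threshold
      \<open>K + n\<close>, so the chosen indices tend to infinity and the estimates from
      \<open>K\<close> on apply.\<close>
    then have "\<exists>k\<ge>K + n. G (Suc k) \<ge> G k - inverse (real (Suc n)) \<and> - 2 * inner p (x (Suc k) - p) > \<epsilon>" for n
      by (metis inverse_positive_iff_positive not_le of_nat_0_less_iff zero_less_Suc)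
    then obtain \<sigma> where \<sigma>: "\<And>n. \<sigma> n \<ge> K + n"
        "\<And>n. G (Suc (\<sigma> n)) \<ge> G (\<sigma> n) - inverse (real (Suc n))"
        "\<And>n. - 2 * inner p (x (Suc (\<sigma> n)) - p) > \<epsilon>"
      by metis
    have bdd_x: "norm (x (\<sigma> n)) \<le> B + norm p" for n
      using B[of "\<sigma> n"] \<sigma>(1)[of n] norm_triangle_sub[of "x (\<sigma> n)" p] by simp
    then have "bounded (range (\<lambda>n. x (\<sigma> n)))"
      by (auto simp: bounded_iff)
    then obtain s l where s: "strict_mono s" and "weakly_converges ((\<lambda>n. x (\<sigma> n)) \<circ> s) l"
      using bounded_imp_weakly_convergent_subsequence[OF separable] by blast
    define \<tau> where "\<tau> n = \<sigma> (s n)" for n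
    have x_weak: "weakly_converges (\<lambda>n. x (\<tau> n)) l"
      using \<open>weakly_converges _ l\<close> by (simp add: \<tau>_def o_def)
    have \<tau>_ge: "\<tau> n \<ge> n" "\<tau> n \<ge> K" for n
      using \<sigma>(1)[of "s n"] seq_suble[OF s, of n] by (auto simp: \<tau>_def)
    have "filterlim \<tau> at_top sequentially"
      using \<tau>_ge(1) by (intro filterlim_at_top_mono[OF filterlim_ident]) auto
    then have \<alpha>_\<tau>: "(\<lambda>n. \<alpha> (\<tau> n)) \<longlonglongrightarrow> 0"
      by (rule filterlim_compose[OF \<alpha>_lim])
    have inv_s: "(\<lambda>n. inverse (real (Suc (s n)))) \<longlonglongrightarrow> 0"
      using LIMSEQ_subseq_LIMSEQ[OF LIMSEQ_inverse_real_of_nat s] by (simp add: o_def)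
    have "(\<lambda>n. (norm (z (\<tau> n) - x (\<tau> n)))\<^sup>2) \<longlonglongrightarrow> 0"
    proof (rule tendsto_sandwich[OF _ _ tendsto_const])
      have "(\<lambda>n. (inverse (real (Suc (s n))) + \<alpha> (\<tau> n) * (norm p)\<^sup>2) / (a * \<delta>))
          \<longlonglongrightarrow> (0 + 0 * (norm p)\<^sup>2) / (a * \<delta>)"
        using a_pos \<open>\<delta> > 0\<close> by (intro tendsto_intros inv_s \<alpha>_\<tau>) auto
      then show "(\<lambda>n. (inverse (real (Suc (s n))) + \<alpha> (\<tau> n) * (norm p)\<^sup>2) / (a * \<delta>)) \<longlonglongrightarrow> 0"
        by simp
      \<comment> \<open>\<open>descent\<close> bounds the residual by the drop of \<open>G\<close>,
        which is at most the reciprocal from the choice of \<open>\<sigma>\<close>.\<close>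
      have "a * \<delta> * (norm (z (\<tau> n) - x (\<tau> n)))\<^sup>2 \<le> inverse (real (Suc (s n))) + \<alpha> (\<tau> n) * (norm p)\<^sup>2" for n
        using descent[OF \<tau>_ge(2)[of n]] \<sigma>(2)[of "s n"] unfolding \<tau>_def by linarith
      then show "\<forall>\<^sub>F n in sequentially. (norm (z (\<tau> n) - x (\<tau> n)))\<^sup>2
          \<le> (inverse (real (Suc (s n))) + \<alpha> (\<tau> n) * (norm p)\<^sup>2) / (a * \<delta>)"
        using a_pos \<open>\<delta> > 0\<close> by (simp add: pos_le_divide_eq mult.commute)
    qed simp
    then have zx: "(\<lambda>n. norm (z (\<tau> n) - x (\<tau> n))) \<longlonglongrightarrow> 0"
      using tendsto_real_sqrt by fastforce
    then have zx': "(\<lambda>n. z (\<tau> n) - x (\<tau> n)) \<longlonglongrightarrow> 0"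
      by (rule tendsto_norm_zero_cancel)
    then have z_weak: "weakly_converges (\<lambda>n. z (\<tau> n)) l"
      by (rule weakly_converges_add_null[OF x_weak])
    obtain D where D: "\<And>n. norm (z (\<tau> n)) \<le> D"
    proof -
      obtain E where "\<And>n. norm (z (\<tau> n) - x (\<tau> n)) \<le> E"
        using convergent_imp_Bseq[OF convergentI[OF zx']] by (auto simp: Bseq_def)
      then have "norm (z (\<tau> n)) \<le> E + (B + norm p)" for n
        using norm_triangle_sub[of "z (\<tau> n)" "x (\<tau> n)"] bdd_x[of "s n"]
        unfolding \<tau>_def by (smt (verit))
      then show ?thesis by (rule that)
    qed
    then have "bounded (range (\<lambda>n. z (\<tau> n)))"
      by (auto simp: bounded_iff)
    then have Fz_weak: "weakly_converges (\<lambda>n. F (z (\<tau> n))) (F l)"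
      using weak_cont z_weak unfolding seq_weak_weak_continuous_on_bounded_def by blast
    have "l \<in> VI_solutions X F"
    proof (rule weak_limit_solves_VI[OF X(2,3) _ pseudo_mono zX z_weak Fz_weak])
      show "continuous_on UNIV F"
        using Lipschitz(2) by (rule lipschitz_on_continuous_on)
      fix y and e :: real
      assume "y \<in> X" "e > 0"
      have "(\<lambda>n. (L + 1 / m) * norm (z (\<tau> n) - x (\<tau> n)) * (norm y + D)) \<longlonglongrightarrow> (L + 1 / m) * 0 * (norm y + D)"
        by (intro tendsto_intros zx)
      then have "\<forall>\<^sub>F n in sequentially. (L + 1 / m) * norm (z (\<tau> n) - x (\<tau> n)) * (norm y + D) < e"
        by (rule order_tendstoD(2)) (use \<open>e > 0\<close> in simp)
      then show "\<forall>\<^sub>F n in sequentially. inner (F (z (\<tau> n))) (y - z (\<tau> n)) \<ge> - e"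
      proof eventually_elim
        case (elim n)
        have "norm (y - z (\<tau> n)) \<le> norm y + D"
          using D[of n] norm_triangle_ineq4[of y "z (\<tau> n)"] by linarith
        then have "(L + 1 / m) * norm (z (\<tau> n) - x (\<tau> n)) * norm (y - z (\<tau> n))
            \<le> (L + 1 / m) * norm (z (\<tau> n) - x (\<tau> n)) * (norm y + D)"
          using Lipschitz(1) \<open>m > 0\<close> by (intro mult_left_mono) auto
        then show ?case
          using elim tseng_step_residual[OF proj[OF \<open>y \<in> X\<close>] \<open>m > 0\<close> \<gamma>_ge Lip, of "\<tau> n"]
          by linarith
      qed
    qed
    \<comment> \<open>The violated inequality concerns \<open>x (Suc (\<tau> n))\<close>, so the
      weak limit must be carried over to the successor.\<close>
    have "(\<lambda>n. x (Suc (\<tau> n)) - x (\<tau> n)) \<longlonglongrightarrow> 0"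
    proof (rule Lim_null_comparison)
      have "(\<lambda>n. (1 + \<gamma> 0 * L) * norm (z (\<tau> n) - x (\<tau> n)) + \<alpha> (\<tau> n) * (B + norm p))
          \<longlonglongrightarrow> (1 + \<gamma> 0 * L) * 0 + 0 * (B + norm p)"
        by (intro tendsto_intros zx \<alpha>_\<tau>)
      then show "(\<lambda>n. (1 + \<gamma> 0 * L) * norm (z (\<tau> n) - x (\<tau> n)) + \<alpha> (\<tau> n) * (B + norm p)) \<longlonglongrightarrow> 0"
        by simp
      have "norm (x (Suc (\<tau> n)) - x (\<tau> n))
          \<le> (1 + \<gamma> 0 * L) * norm (z (\<tau> n) - x (\<tau> n)) + \<alpha> (\<tau> n) * (B + norm p)" for n
      proof -
        let ?k = "\<tau> n"
        have "norm (r ?k - x ?k) \<le> norm (z ?k - x ?k) + \<gamma> ?k * norm (F (x ?k) - F (z ?k))"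
          using norm_triangle_ineq[of "z ?k - x ?k" "\<gamma> ?k *\<^sub>R (F (x ?k) - F (z ?k))"] \<gamma>_pos[of ?k]
          by (simp add: r_def diff_add_eq)
        also have "\<gamma> ?k * norm (F (x ?k) - F (z ?k)) \<le> \<gamma> 0 * (L * norm (z ?k - x ?k))"
          using Lip[of "x ?k" "z ?k"] \<gamma>_le[of ?k] \<gamma>_init
          by (intro mult_mono) (auto simp: norm_minus_commute)
        finally have "norm (r ?k - x ?k) \<le> (1 + \<gamma> 0 * L) * norm (z ?k - x ?k)"
          by (simp add: algebra_simps)
        moreover have "\<beta> ?k * norm (r ?k - x ?k) \<le> norm (r ?k - x ?k)"
          using \<beta>[of ?k] by (intro mult_left_le_one_le) auto
        moreover have "\<alpha> ?k * norm (x ?k) \<le> \<alpha> ?k * (B + norm p)"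
          using \<alpha>[of ?k] bdd_x[of "s n"] by (simp add: \<tau>_def)
        moreover have "x (Suc ?k) - x ?k = \<beta> ?k *\<^sub>R (r ?k - x ?k) - \<alpha> ?k *\<^sub>R x ?k"
          by (simp add: x_step algebra_simps)
        then have "norm (x (Suc ?k) - x ?k) \<le> \<beta> ?k * norm (r ?k - x ?k) + \<alpha> ?k * norm (x ?k)"
          using norm_triangle_ineq4[of "\<beta> ?k *\<^sub>R (r ?k - x ?k)" "\<alpha> ?k *\<^sub>R x ?k"] \<alpha>[of ?k] \<beta>[of ?k]
          by simp
        ultimately show ?thesis by linarith
      qed
      then show "\<forall>\<^sub>F n in sequentially. norm (x (Suc (\<tau> n)) - x (\<tau> n))
          \<le> (1 + \<gamma> 0 * L) * norm (z (\<tau> n) - x (\<tau> n)) + \<alpha> (\<tau> n) * (B + norm p)"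
        by simp
    qed
    then have "weakly_converges (\<lambda>n. x (Suc (\<tau> n))) l"
      by (rule weakly_converges_add_null[OF x_weak])
    then have "(\<lambda>n. - 2 * inner p (x (Suc (\<tau> n)) - p)) \<longlonglongrightarrow> - 2 * inner p (l - p)"
      by (intro tendsto_mult_left weakly_converges_inner_diff)
    then have "\<epsilon> \<le> - 2 * inner p (l - p)"
      by (rule LIMSEQ_le_const) (use \<sigma>(3) in \<open>auto simp: \<tau>_def intro!: less_imp_le\<close>)
    then show False
      using p_min[OF \<open>l \<in> VI_solutions X F\<close>] \<open>\<epsilon> > 0\<close> by simp
  qed

  \<comment> \<open>Conclusion from the recursion\<close>
  \<comment> \<open>One \<open>\<epsilon>\<close> is the level in the recursion, the other the slack
    in its conclusion.\<close>
  have G_small: "\<forall>\<^sub>F k in sequentially. G k \<le> \<epsilon> + \<epsilon>" if \<epsilon>: "\<epsilon> > 0" for \<epsilon>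
  proof (rule contraction_recursion_eventually_le[OF _ _ \<alpha>_sum _ that])
    obtain \<eta> N where "\<eta> > 0"
      and N: "\<And>k. k \<ge> N \<Longrightarrow> G (Suc k) \<ge> G k - \<eta> \<Longrightarrow> - 2 * inner p (x (Suc k) - p) \<le> \<epsilon>"
      using key[OF \<epsilon>] by blast
    have "(\<lambda>k. \<alpha> k * B\<^sup>2) \<longlonglongrightarrow> 0 * B\<^sup>2"
      by (intro tendsto_intros \<alpha>_lim)
    then have "\<forall>\<^sub>F k in sequentially. \<alpha> k * B\<^sup>2 < \<eta>"
      by (rule order_tendstoD(2)) (use \<open>\<eta> > 0\<close> in simp)
    then show "\<forall>\<^sub>F k in sequentially. G (Suc k) \<le> (1 - \<alpha> k) * G k + \<alpha> k * \<epsilon>"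
      using eventually_ge_at_top[of N] eventually_ge_at_top[of K]
    proof eventually_elim
      case (elim k)
      show ?case
      proof (cases "G (Suc k) \<ge> G k - \<eta>")
        case True
        then have "\<alpha> k * (- 2 * inner p (x (Suc k) - p)) \<le> \<alpha> k * \<epsilon>"
          using N elim \<alpha>[of k] by (intro mult_left_mono) auto
        then show ?thesis
          using contraction[of k] elim by linarith
      next
        case False
        \<comment> \<open>A drop by more than \<open>\<eta>\<close> exceeds
          \<open>\<alpha> k * G k\<close>, which yields the recursion without
          \<open>contraction\<close>.\<close>
        have "\<alpha> k * G k \<le> \<alpha> k * B\<^sup>2"
          using B[of k] elim \<alpha>[of k] by (auto simp: G_def intro!: mult_left_mono power_mono)
        moreover have "0 \<le> \<alpha> k * \<epsilon>"
          using \<alpha>[of k] that by simp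
        ultimately show ?thesis
          using False elim by (simp add: left_diff_distrib)
      qed
    qed
  qed (use \<alpha> in \<open>auto intro: less_imp_le\<close>)
  have "G \<longlonglongrightarrow> 0"
  proof (rule order_tendstoI)
    fix e :: real
    assume "e < 0"
    then show "\<forall>\<^sub>F k in sequentially. e < G k"
      by (auto simp: G_def intro!: always_eventually less_le_trans[of e 0])
  next
    fix e :: real
    assume "0 < e"
    then show "\<forall>\<^sub>F k in sequentially. G k < e"
      using G_small[of "e / 3"] by (auto elim!: eventually_mono)
  qed
  then have "(\<lambda>k. norm (x k - p)) \<longlonglongrightarrow> 0"
    unfolding G_def using tendsto_real_sqrt by fastforce
  then show ?thesis
    unfolding p_def[symmetric] by (simp add: tendsto_norm_zero_iff LIM_zero_iff)
qed

end
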